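(* Let $K$ be a field. The variety $\mathcal{C}_K$ of all commutative (not necessarily associative) $K$-algebras is MLM. That is: for every field extension $K\subseteq F$, every commutative $F$-algebra $A$ and every finite subset $Y=\{y_1,\dots,y_n\}\subseteq A$ of at least two elements such that the $K$-subalgebra of $A$ generated by $Y$ is the free commutative $K$-algebra with set of free generators $Y$, the $F$-subalgebra of $A$ generated by $Y$ is the free commutative $F$-algebra with set of free generators $Y$.
   Context: Algebras over a field are vector spaces with a bilinear product; they are not assumed to be associative or to have a unit. A commutative algebra is one satisfying the identity $x_1x_2-x_2x_1=0$ (associativity is not required). The free commutative $K$-algebra with set of free generators $Y$ is the commutative $K$-algebra containing $Y$ such that every map from $Y$ to a commutative $K$-algebra extends uniquely to a $K$-algebra homomorphism. *)

theory Defs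
  imports "HOL-Algebra.Module" "HOL-Algebra.Subrings"
begin

text \<open>
  Algebras are records of type \<^typ>\<open>('r, 'a) module\<close>. The field \<^const>\<open>one\<close> of the record
  carries no meaning here, since algebras need not be unital; associativity of the product is not
  required either.
\<close>

locale nonassoc_algebra = R?: field R + module R A for R (structure) and A (structure) +
  assumes mult_closed:
      "\<lbrakk>x \<in> carrier A; y \<in> carrier A\<rbrakk> \<Longrightarrow> x \<otimes>\<^bsub>A\<^esub> y \<in> carrier A"
    and mult_add_left:
      "\<lbrakk>x \<in> carrier A; y \<in> carrier A; z \<in> carrier A\<rbrakk> \<Longrightarrow>
       (x \<oplus>\<^bsub>A\<^esub> y) \<otimes>\<^bsub>A\<^esub> z = (x \<otimes>\<^bsub>A\<^esub> z) \<oplus>\<^bsub>A\<^esub> (y \<otimes>\<^bsub>A\<^esub> z)"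
    and mult_add_right:
      "\<lbrakk>x \<in> carrier A; y \<in> carrier A; z \<in> carrier A\<rbrakk> \<Longrightarrow>
       x \<otimes>\<^bsub>A\<^esub> (y \<oplus>\<^bsub>A\<^esub> z) = (x \<otimes>\<^bsub>A\<^esub> y) \<oplus>\<^bsub>A\<^esub> (x \<otimes>\<^bsub>A\<^esub> z)"
    and mult_smult_left:
      "\<lbrakk>a \<in> carrier R; x \<in> carrier A; y \<in> carrier A\<rbrakk> \<Longrightarrow>
       (a \<odot>\<^bsub>A\<^esub> x) \<otimes>\<^bsub>A\<^esub> y = a \<odot>\<^bsub>A\<^esub> (x \<otimes>\<^bsub>A\<^esub> y)"
    and mult_smult_right:
      "\<lbrakk>a \<in> carrier R; x \<in> carrier A; y \<in> carrier A\<rbrakk> \<Longrightarrow>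
       x \<otimes>\<^bsub>A\<^esub> (a \<odot>\<^bsub>A\<^esub> y) = a \<odot>\<^bsub>A\<^esub> (x \<otimes>\<^bsub>A\<^esub> y)"

locale commutative_algebra = nonassoc_algebra +
  assumes mult_commute:
      "\<lbrakk>x \<in> carrier A; y \<in> carrier A\<rbrakk> \<Longrightarrow> (x \<otimes>\<^bsub>A\<^esub> y) \<ominus>\<^bsub>A\<^esub> (y \<otimes>\<^bsub>A\<^esub> x) = \<zero>\<^bsub>A\<^esub>"

definition subalgebra ::
  "'a set \<Rightarrow> ('r, 'm) ring_scheme \<Rightarrow> ('r, 'a, 'n) module_scheme \<Rightarrow> bool" where
  "subalgebra S R A \<longleftrightarrow> submodule S R A \<and> (\<forall>x\<in>S. \<forall>y\<in>S. x \<otimes>\<^bsub>A\<^esub> y \<in> S)"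

definition generated_subalgebra ::
  "('r, 'm) ring_scheme \<Rightarrow> ('r, 'a, 'n) module_scheme \<Rightarrow> 'a set \<Rightarrow> ('r, 'a, 'n) module_scheme" where
  "generated_subalgebra R A Y = A\<lparr>carrier := \<Inter>{S. subalgebra S R A \<and> Y \<subseteq> S}\<rparr>"

definition algebra_hom ::
  "('r, 'm) ring_scheme \<Rightarrow> ('r, 'a, 'n) module_scheme \<Rightarrow> ('r, 'b, 'p) module_scheme \<Rightarrow> ('a \<Rightarrow> 'b) set"
  where
  "algebra_hom R A B = {h \<in> carrier A \<rightarrow> carrier B.
     (\<forall>x\<in>carrier A. \<forall>y\<in>carrier A. h (x \<oplus>\<^bsub>A\<^esub> y) = h x \<oplus>\<^bsub>B\<^esub> h y) \<and>
     (\<forall>x\<in>carrier A. \<forall>y\<in>carrier A. h (x \<otimes>\<^bsub>A\<^esub> y) = h x \<otimes>\<^bsub>B\<^esub> h y) \<and>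
     (\<forall>a\<in>carrier R. \<forall>x\<in>carrier A. h (a \<odot>\<^bsub>A\<^esub> x) = a \<odot>\<^bsub>B\<^esub> h x)}"

text \<open>
  A formula cannot quantify over types, so the universal property is relative to a type \<open>'b\<close>
  containing the carriers of the test algebras \<open>B\<close>. When \<open>A\<close> is generated by a countable set \<open>Y\<close>,
  the type \<^typ>\<open>nat \<Rightarrow> 'r\<close> (with \<open>'r\<close> the type of scalars) suffices: if the property holds for it,
  then it holds for every \<open>'b\<close>. Indeed only the subalgebra of \<open>B\<close> generated by the countable image
  of \<open>Y\<close> matters. It is spanned by countably many monomials, so its cardinality is at most that of
  \<^typ>\<open>nat \<Rightarrow> 'r\<close>, and it has an isomorphic copy with carrier in that type.

  Homomorphisms are taken to be \<^const>\<open>extensional\<close> so that uniqueness refers only to their values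
  on the carrier.
\<close>

definition free_commutative_algebra ::
  "'b itself \<Rightarrow> ('r, 'm) ring_scheme \<Rightarrow> ('r, 'a, 'n) module_scheme \<Rightarrow> 'a set \<Rightarrow> bool" where
  "free_commutative_algebra (_ :: 'b itself) R A Y \<longleftrightarrow>
     commutative_algebra R A \<and> Y \<subseteq> carrier A \<and>
     (\<forall>B :: ('r, 'b) module. commutative_algebra R B \<longrightarrow>
       (\<forall>f \<in> Y \<rightarrow> carrier B.
         \<exists>!h. h \<in> algebra_hom R A B \<and> h \<in> extensional (carrier A) \<and> (\<forall>y\<in>Y. h y = f y)))"

end

theory Submission
  imports Defs "HOL-Library.Nat_Bijection"
begin

text \<open>
  Let \<open>L\<^sub>F\<close> be the free commutative \<open>F\<close>-algebra on letters in bijection with \<open>Y\<close>. Its basis consists of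
  the commutative nonassociative words, and inside it lies the free \<open>K\<close>-algebra \<open>L\<^sub>K\<close> of elements
  with coefficients in \<open>K\<close>. The letters go to the elements of \<open>Y\<close> under a homomorphism
  \<open>\<Phi> : L\<^sub>F \<rightarrow> A\<close> whose image is the \<open>F\<close>-subalgebra generated by \<open>Y\<close>, so everything comes down to the
  injectivity of \<open>\<Phi>\<close>. The freeness over \<open>K\<close> says that the ideal \<open>ker \<Phi>\<close> meets \<open>L\<^sub>K\<close> only in \<open>0\<close>
  (\<open>word_map_retraction_over_subfield\<close>). The heart of the proof is that an ideal \<open>I\<close> of \<open>L\<^sub>F\<close> with
  \<open>I \<inter> L\<^sub>K = 0\<close> is zero (\<open>ideal_trivial_if_trivial_over_subfield\<close>).

  Suppose that \<open>z = f\<^sub>0 a\<^sub>0 + \<dots> + f\<^sub>r a\<^sub>r\<close> lies in \<open>I\<close>, with \<open>f\<^sub>i\<close> in \<open>F\<close> and with elements \<open>a\<^sub>i\<close> of \<open>L\<^sub>K\<close>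
  that are linearly independent over \<open>K\<close>. Take a word \<open>U\<close> longer than all words in the \<open>a\<^sub>i\<close>, and
  apply \<open>x \<mapsto> a\<^sub>0 (U x) - (a\<^sub>0 U) x\<close>, which preserves \<open>I\<close>, to \<open>z\<close>. The \<open>a\<^sub>0\<close>-term disappears by
  commutativity, and \<open>f\<^sub>1 b\<^sub>1 + \<dots> + f\<^sub>r b\<^sub>r\<close> remains, where \<open>b\<^sub>i = a\<^sub>0 (U a\<^sub>i) - (a\<^sub>0 U) a\<^sub>i\<close> is again in
  \<open>L\<^sub>K\<close>. Since \<open>U\<close> is long, a word \<open>m (m' U)\<close> with \<open>m\<close> and \<open>m'\<close> shorter than \<open>U\<close> determines \<open>m\<close> and \<open>m'\<close>,
  and its coefficient in \<open>a\<^sub>0 (U x) - (a\<^sub>0 U) x\<close> is the minor of the coefficient vectors of \<open>a\<^sub>0\<close> and \<open>x\<close>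
  in the columns \<open>m\<close> and \<open>m'\<close>. So this element vanishes only if \<open>x\<close> is proportional to \<open>a\<^sub>0\<close>. Hence the
  \<open>b\<^sub>i\<close> are linearly independent over \<open>K\<close>, and induction on \<open>r\<close> gives \<open>f\<^sub>1 = \<dots> = f\<^sub>r = 0\<close>. Then
  \<open>f\<^sub>0 a\<^sub>0\<close> lies in \<open>I\<close>; if \<open>f\<^sub>0\<close> were nonzero, \<open>a\<^sub>0\<close> would be a nonzero element of \<open>I \<inter> L\<^sub>K\<close>.
\<close>

section \<open>Commutative nonassociative words\<close>

text \<open>The pair \<open>(min i j, max i j - min i j)\<close> encodes the multiset \<open>{i, j}\<close> bijectively. Hence, for
  \<open>N > 0\<close>, every natural number is either one of the \<open>N\<close> letters \<open>0, \<dots>, N - 1\<close> or the product of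
  exactly one unordered pair of natural numbers, and these are smaller: \<open>nat\<close> with this product is
  the free commutative magma on \<open>N\<close> letters. Working with numbers rather than trees places the
  free algebra in the type \<open>nat \<Rightarrow> 'f\<close> and lets the order of \<open>nat\<close> play the part of the degree.\<close>

definition word_prod :: "nat \<Rightarrow> nat \<Rightarrow> nat \<Rightarrow> nat" where
  "word_prod N i j = N + prod_encode (min i j, max i j - min i j)"

lemma word_prod_commute: "word_prod N i j = word_prod N j i"
  by (simp add: word_prod_def min.commute max.commute)

lemma word_prod_not_letter: "\<not> word_prod N i j < N"
  by (simp add: word_prod_def)

lemma word_prod_eq_iff:
  "word_prod N i j = word_prod N k l \<longleftrightarrow> i = k \<and> j = l \<or> i = l \<and> j = k"
  by (auto simp: word_prod_def min_def max_def)

lemma sum_le_prod_encode: "p + q \<le> prod_encode (p, q)"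
proof -
  have "k \<le> triangle k" for k by (induction k) auto
  then show ?thesis by (simp add: prod_encode_def trans_le_add1)
qed

lemma word_prod_greater:
  assumes "N > 0" shows "i < word_prod N i j" "j < word_prod N i j"
  using sum_le_prod_encode[of "min i j" "max i j - min i j"] assms
  by (auto simp: word_prod_def)

text \<open>Undoing the pairing: the number \<open>N + prod_encode (p, q)\<close> is the product of \<open>p\<close> and \<open>p + q\<close>.\<close>

lemma word_cases:
  obtains (letter) "n < N" | (product) i j where "n = word_prod N i j"
proof (cases "n < N")
  case False
  obtain p q where "prod_decode (n - N) = (p, q)" by fastforce
  then have "n - N = prod_encode (p, q)" by (metis prod_decode_inverse)
  with False have "n = word_prod N p (p + q)" by (simp add: word_prod_def)
  with product show thesis by blast
qed (use letter in blast)

lemma word_induct [consumes 1, case_names letter product]: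
  assumes "N > 0" and "\<And>i. i < N \<Longrightarrow> P i" and "\<And>i j. P i \<Longrightarrow> P j \<Longrightarrow> P (word_prod N i j)"
  shows "P n"
proof (induction n rule: less_induct)
  case (less n)
  show ?case
    by (cases n rule: word_cases[where N = N])
       (use less assms word_prod_greater[OF \<open>N > 0\<close>] in auto)
qed

text \<open>The value of a word when the letters are replaced by \<open>y\<close> and the product by \<open>m\<close>. The
  recursion multiplies the two factors in increasing order, so that it is a homomorphism only into
  commutative structures.\<close>

function word_eval :: "nat \<Rightarrow> ('a \<Rightarrow> 'a \<Rightarrow> 'a) \<Rightarrow> (nat \<Rightarrow> 'a) \<Rightarrow> nat \<Rightarrow> 'a" where
  "word_eval N m y n = (if N = 0 \<or> n < N then y n
     else m (word_eval N m y (fst (prod_decode (n - N))))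
            (word_eval N m y (fst (prod_decode (n - N)) + snd (prod_decode (n - N)))))"
  by auto
termination
proof (relation "Wellfounded.measure (\<lambda>(N, m, y, n). n)", goal_cases)
  case (2 N m y n)
  then show ?case
    using sum_le_prod_encode[of "fst (prod_decode (n - N))" "snd (prod_decode (n - N))"] by auto
next
  case (3 N m y n)
  then show ?case
    using sum_le_prod_encode[of "fst (prod_decode (n - N))" "snd (prod_decode (n - N))"] by auto
qed auto

declare word_eval.simps [simp del]

lemma word_eval_letter: "n < N \<Longrightarrow> word_eval N m y n = y n"
  by (simp add: word_eval.simps)

lemma word_eval_product:
  assumes "N > 0"
  shows "word_eval N m y (word_prod N i j)
           = m (word_eval N m y (min i j)) (word_eval N m y (max i j))"
  using assms by (subst word_eval.simps) (simp add: word_prod_def)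


section \<open>The algebra spanned by the words\<close>

text \<open>Two different words \<open>i\<close> and \<open>j\<close> contribute to the coefficient of their product
  in either order, one word in only one.\<close>

definition coeff_mult ::
  "('r, 'm) ring_scheme \<Rightarrow> nat \<Rightarrow> (nat \<Rightarrow> 'r) \<Rightarrow> (nat \<Rightarrow> 'r) \<Rightarrow> nat \<Rightarrow> 'r" where
  "coeff_mult R N c d n =
     (if n < N then \<zero>\<^bsub>R\<^esub> else
      case prod_decode (n - N) of (p, q) \<Rightarrow>
        if q = 0 then c p \<otimes>\<^bsub>R\<^esub> d p
        else (c p \<otimes>\<^bsub>R\<^esub> d (p + q)) \<oplus>\<^bsub>R\<^esub> (c (p + q) \<otimes>\<^bsub>R\<^esub> d p))"

definition word_algebra :: "('r, 'm) ring_scheme \<Rightarrow> nat \<Rightarrow> ('r, nat \<Rightarrow> 'r) module" where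
  "word_algebra R N =
     \<lparr>carrier = {c. (\<forall>n. c n \<in> carrier R) \<and> finite {n. c n \<noteq> \<zero>\<^bsub>R\<^esub>}},
      mult = coeff_mult R N, one = undefined,
      zero = (\<lambda>n. \<zero>\<^bsub>R\<^esub>), add = (\<lambda>c d n. c n \<oplus>\<^bsub>R\<^esub> d n),
      smult = (\<lambda>a c n. a \<otimes>\<^bsub>R\<^esub> c n)\<rparr>"

definition word_vec :: "('r, 'm) ring_scheme \<Rightarrow> nat \<Rightarrow> nat \<Rightarrow> 'r" where
  "word_vec R n = (\<lambda>k. if k = n then \<one>\<^bsub>R\<^esub> else \<zero>\<^bsub>R\<^esub>)"

lemma coeff_mult_letter: "n < N \<Longrightarrow> coeff_mult R N c d n = \<zero>\<^bsub>R\<^esub>"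
  by (simp add: coeff_mult_def)

lemma coeff_mult_subfield [simp]: "coeff_mult (R\<lparr>carrier := K\<rparr>) N = coeff_mult R N"
  by (intro ext) (simp add: coeff_mult_def split: prod.split)

lemma word_vec_subfield [simp]: "word_vec (R\<lparr>carrier := K\<rparr>) = word_vec R"
  by (intro ext) (simp add: word_vec_def)

lemma word_algebra_simps [simp]:
  "x \<otimes>\<^bsub>word_algebra R N\<^esub> y = coeff_mult R N x y"
  "\<zero>\<^bsub>word_algebra R N\<^esub> = (\<lambda>n. \<zero>\<^bsub>R\<^esub>)"
  "x \<oplus>\<^bsub>word_algebra R N\<^esub> y = (\<lambda>n. x n \<oplus>\<^bsub>R\<^esub> y n)"
  "a \<odot>\<^bsub>word_algebra R N\<^esub> x = (\<lambda>n. a \<otimes>\<^bsub>R\<^esub> x n)"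
  by (simp_all add: word_algebra_def)

lemma word_algebra_carrier:
  "c \<in> carrier (word_algebra R N) \<longleftrightarrow> (\<forall>n. c n \<in> carrier R) \<and> finite {n. c n \<noteq> \<zero>\<^bsub>R\<^esub>}"
  by (simp add: word_algebra_def)

context field
begin

lemma coeff_mult_product:
  assumes "\<And>n. c n \<in> carrier R" "\<And>n. d n \<in> carrier R"
  shows "coeff_mult R N c d (word_prod N i j)
           = (if i = j then c i \<otimes> d i else (c i \<otimes> d j) \<oplus> (c j \<otimes> d i))"
proof -
  consider "i = j" | "i < j" | "j < i" by linarith
  then show ?thesis
    by cases (simp_all add: coeff_mult_def word_prod_def assms a_comm)
qed

lemma coeff_mult_in_carrier:
  assumes "\<And>n. c n \<in> carrier R" "\<And>n. d n \<in> carrier R"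
  shows "coeff_mult R N c d n \<in> carrier R"
  by (simp add: coeff_mult_def assms split: prod.split)

lemma coeff_mult_commute:
  assumes "\<And>n. c n \<in> carrier R" "\<And>n. d n \<in> carrier R"
  shows "coeff_mult R N c d = coeff_mult R N d c"
  by (rule ext) (simp add: coeff_mult_def assms m_comm a_comm split: prod.split)

lemma coeff_mult_add:
  assumes "\<And>n. c n \<in> carrier R" "\<And>n. d n \<in> carrier R" "\<And>n. e n \<in> carrier R"
  shows "coeff_mult R N c (\<lambda>n. d n \<oplus> e n) = (\<lambda>n. coeff_mult R N c d n \<oplus> coeff_mult R N c e n)"
  by (rule ext) (simp add: coeff_mult_def assms r_distr a_ac split: prod.split)

lemma coeff_mult_smult:
  assumes "\<And>n. c n \<in> carrier R" "\<And>n. d n \<in> carrier R" "a \<in> carrier R"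
  shows "coeff_mult R N c (\<lambda>n. a \<otimes> d n) = (\<lambda>n. a \<otimes> coeff_mult R N c d n)"
  by (rule ext) (simp add: coeff_mult_def assms r_distr m_lcomm split: prod.split)

lemma coeff_mult_finsum:
  assumes "finite I" "\<And>n. c n \<in> carrier R" "\<And>i n. i \<in> I \<Longrightarrow> d i n \<in> carrier R"
  shows "coeff_mult R N c (\<lambda>n. \<Oplus>i\<in>I. d i n) = (\<lambda>n. \<Oplus>i\<in>I. coeff_mult R N c (d i) n)"
  using assms(1,3)
proof (induction I rule: finite_induct)
  case empty
  show ?case
    by (rule ext) (simp add: coeff_mult_def assms(2) split: prod.split)
next
  case (insert i I)
  have "(\<Oplus>k\<in>insert i I. d k n) = d i n \<oplus> (\<Oplus>k\<in>I. d k n)" for n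
    using insert by (intro finsum_insert) auto
  moreover have "(\<Oplus>k\<in>insert i I. coeff_mult R N c (d k) n)
      = coeff_mult R N c (d i) n \<oplus> (\<Oplus>k\<in>I. coeff_mult R N c (d k) n)" for n
    using insert assms(2) by (intro finsum_insert) (auto intro!: coeff_mult_in_carrier)
  moreover have "(\<Oplus>k\<in>I. d k n) \<in> carrier R" for n
    using insert by (intro finsum_closed) auto
  ultimately show ?case
    using insert assms(2) by (simp add: coeff_mult_add)
qed

lemma word_vec_in_carrier [simp]: "word_vec R n k \<in> carrier R"
  by (simp add: word_vec_def)

lemma word_vec_in_algebra [simp]: "word_vec R n \<in> carrier (word_algebra R N)"
  by (simp add: word_algebra_carrier) (simp add: word_vec_def)

lemma coeff_mult_word_vec:
  "coeff_mult R N (word_vec R i) (word_vec R j) = word_vec R (word_prod N i j)"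
proof
  fix n
  show "coeff_mult R N (word_vec R i) (word_vec R j) n = word_vec R (word_prod N i j) n"
  proof (cases n rule: word_cases[where N = N])
    case letter
    then show ?thesis
      using word_prod_not_letter[of N i j] by (auto simp: coeff_mult_letter word_vec_def)
  next
    case (product k l)
    show ?thesis
      unfolding product
      by (subst coeff_mult_product) (auto simp: word_vec_def word_prod_eq_iff)
  qed
qed

text \<open>A word in the support of a product is the product of words in the supports of the factors.\<close>

lemma word_algebra_mult_closed:
  assumes "c \<in> carrier (word_algebra R N)" "d \<in> carrier (word_algebra R N)"
  shows "coeff_mult R N c d \<in> carrier (word_algebra R N)"
proof -
  have c: "\<And>n. c n \<in> carrier R" and d: "\<And>n. d n \<in> carrier R"
    and fin: "finite {n. c n \<noteq> \<zero>}" "finite {n. d n \<noteq> \<zero>}"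
    using assms by (auto simp: word_algebra_carrier)
  have "n \<in> (\<lambda>(i, j). word_prod N i j) ` ({n. c n \<noteq> \<zero>} \<times> {n. d n \<noteq> \<zero>})"
    if "coeff_mult R N c d n \<noteq> \<zero>" for n
  proof (cases n rule: word_cases[where N = N])
    case letter
    with that show ?thesis by (simp add: coeff_mult_letter)
  next
    case (product i j)
    have "c i \<noteq> \<zero> \<and> d j \<noteq> \<zero> \<or> c j \<noteq> \<zero> \<and> d i \<noteq> \<zero>"
      using that unfolding product by (subst (asm) coeff_mult_product) (auto simp: c d split: if_splits)
    then have "(i, j) \<in> {n. c n \<noteq> \<zero>} \<times> {n. d n \<noteq> \<zero>} \<or> (j, i) \<in> {n. c n \<noteq> \<zero>} \<times> {n. d n \<noteq> \<zero>}"
      by auto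
    then show ?thesis
      unfolding product using word_prod_commute[of N i j]
      by (elim disjE) (erule rev_image_eqI, simp)+
  qed
  then have "{n. coeff_mult R N c d n \<noteq> \<zero>}
      \<subseteq> (\<lambda>(i, j). word_prod N i j) ` ({n. c n \<noteq> \<zero>} \<times> {n. d n \<noteq> \<zero>})"
    by blast
  then have "finite {n. coeff_mult R N c d n \<noteq> \<zero>}"
    by (rule finite_subset) (use fin in simp)
  then show ?thesis
    using c d by (simp add: word_algebra_carrier coeff_mult_in_carrier)
qed

lemma word_algebra_add_closed:
  assumes "c \<in> carrier (word_algebra R N)" "d \<in> carrier (word_algebra R N)"
  shows "(\<lambda>n. c n \<oplus> d n) \<in> carrier (word_algebra R N)"
proof -
  have "finite ({n. c n \<noteq> \<zero>} \<union> {n. d n \<noteq> \<zero>})"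
    using assms by (simp add: word_algebra_carrier)
  then have "finite {n. c n \<oplus> d n \<noteq> \<zero>}"
    by (rule rev_finite_subset) auto
  then show ?thesis using assms by (simp add: word_algebra_carrier)
qed

lemma word_algebra_smult_closed:
  assumes "a \<in> carrier R" "c \<in> carrier (word_algebra R N)"
  shows "(\<lambda>n. a \<otimes> c n) \<in> carrier (word_algebra R N)"
proof -
  have "finite {n. c n \<noteq> \<zero>}"
    using assms by (simp add: word_algebra_carrier)
  then have "finite {n. a \<otimes> c n \<noteq> \<zero>}"
    by (rule rev_finite_subset) (use assms in auto)
  then show ?thesis using assms by (simp add: word_algebra_carrier)
qed

lemma word_algebra_commutative_algebra: "commutative_algebra R (word_algebra R N)"
proof -
  let ?L = "word_algebra R N"
  have ag: "abelian_group ?L"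
  proof (rule abelian_groupI)
    fix c assume c: "c \<in> carrier ?L"
    show "\<exists>d\<in>carrier ?L. d \<oplus>\<^bsub>?L\<^esub> c = \<zero>\<^bsub>?L\<^esub>"
    proof
      show "(\<lambda>n. \<ominus> \<one> \<otimes> c n) \<in> carrier ?L"
        by (rule word_algebra_smult_closed) (use c in auto)
      show "(\<lambda>n. \<ominus> \<one> \<otimes> c n) \<oplus>\<^bsub>?L\<^esub> c = \<zero>\<^bsub>?L\<^esub>"
        using c by (simp add: word_algebra_carrier l_minus l_neg)
    qed
  qed (simp_all add: word_algebra_add_closed, simp_all add: word_algebra_carrier a_ac)
  have mod: "module R ?L"
    by (rule moduleI[OF is_cring ag])
       (simp_all add: word_algebra_smult_closed,
        simp_all add: word_algebra_carrier l_distr r_distr m_assoc)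
  interpret L: module R ?L by (rule mod)
  show ?thesis
  proof (intro commutative_algebra.intro nonassoc_algebra.intro nonassoc_algebra_axioms.intro
      commutative_algebra_axioms.intro mod)
    show "field R" by (rule field_axioms)
    show "x \<otimes>\<^bsub>?L\<^esub> y \<in> carrier ?L" if "x \<in> carrier ?L" "y \<in> carrier ?L" for x y
      using that by (simp add: word_algebra_mult_closed)
    have comm: "x \<otimes>\<^bsub>?L\<^esub> y = y \<otimes>\<^bsub>?L\<^esub> x" if "x \<in> carrier ?L" "y \<in> carrier ?L" for x y
      using that by (simp add: word_algebra_carrier coeff_mult_commute)
    show add_right: "x \<otimes>\<^bsub>?L\<^esub> (y \<oplus>\<^bsub>?L\<^esub> z) = (x \<otimes>\<^bsub>?L\<^esub> y) \<oplus>\<^bsub>?L\<^esub> (x \<otimes>\<^bsub>?L\<^esub> z)"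
      if "x \<in> carrier ?L" "y \<in> carrier ?L" "z \<in> carrier ?L" for x y z
      using that by (simp add: word_algebra_carrier coeff_mult_add)
    show "(x \<oplus>\<^bsub>?L\<^esub> y) \<otimes>\<^bsub>?L\<^esub> z = (x \<otimes>\<^bsub>?L\<^esub> z) \<oplus>\<^bsub>?L\<^esub> (y \<otimes>\<^bsub>?L\<^esub> z)"
      if "x \<in> carrier ?L" "y \<in> carrier ?L" "z \<in> carrier ?L" for x y z
      using that by (simp add: comm[of _ z] add_right del: word_algebra_simps)
    show smult_right: "x \<otimes>\<^bsub>?L\<^esub> (a \<odot>\<^bsub>?L\<^esub> y) = a \<odot>\<^bsub>?L\<^esub> (x \<otimes>\<^bsub>?L\<^esub> y)"
      if "a \<in> carrier R" "x \<in> carrier ?L" "y \<in> carrier ?L" for a x y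
      using that by (simp add: word_algebra_carrier coeff_mult_smult)
    show "(a \<odot>\<^bsub>?L\<^esub> x) \<otimes>\<^bsub>?L\<^esub> y = a \<odot>\<^bsub>?L\<^esub> (x \<otimes>\<^bsub>?L\<^esub> y)"
      if "a \<in> carrier R" "x \<in> carrier ?L" "y \<in> carrier ?L" for a x y
      using that by (simp add: comm[of _ y] smult_right del: word_algebra_simps)
    show "(x \<otimes>\<^bsub>?L\<^esub> y) \<ominus>\<^bsub>?L\<^esub> (y \<otimes>\<^bsub>?L\<^esub> x) = \<zero>\<^bsub>?L\<^esub>"
      if "x \<in> carrier ?L" "y \<in> carrier ?L" for x y
    proof -
      have "y \<otimes>\<^bsub>?L\<^esub> x \<in> carrier ?L"
        using that by (simp add: word_algebra_mult_closed)
      then show ?thesis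
        unfolding comm[OF that] by (rule L.r_neg[folded a_minus_def])
    qed
  qed
qed

lemma word_algebra_induct [consumes 1, case_names zero add]:
  assumes "c \<in> carrier (word_algebra R N)"
    and "P (\<lambda>n. \<zero>)"
    and "\<And>a n c. a \<in> carrier R \<Longrightarrow> c \<in> carrier (word_algebra R N) \<Longrightarrow> P c \<Longrightarrow>
           P (\<lambda>k. a \<otimes> word_vec R n k \<oplus> c k)"
  shows "P c"
proof -
  have "finite {n. c n \<noteq> \<zero>}" "\<And>n. c n \<in> carrier R"
    using assms(1) by (simp_all add: word_algebra_carrier)
  then show ?thesis
  proof (induction "{n. c n \<noteq> \<zero>}" arbitrary: c rule: finite_induct)
    case empty
    then have "c = (\<lambda>n. \<zero>)" by (intro ext) auto
    then show ?case using assms(2) by simp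
  next
    case (insert n S)
    define d where "d = c(n := \<zero>)"
    have S: "S = {n. d n \<noteq> \<zero>}"
      using insert(2,4) by (auto simp: d_def)
    have d: "\<And>n. d n \<in> carrier R"
      using insert.prems by (simp add: d_def)
    have "d \<in> carrier (word_algebra R N)"
      using d insert(1) S by (simp add: word_algebra_carrier)
    moreover have "P d" using insert(3)[OF S d] .
    ultimately have "P (\<lambda>k. c n \<otimes> word_vec R n k \<oplus> d k)"
      using assms(3) insert.prems by blast
    also have "(\<lambda>k. c n \<otimes> word_vec R n k \<oplus> d k) = c"
      using insert.prems by (intro ext) (simp add: d_def word_vec_def)
    finally show ?case .
  qed
qed

end


section \<open>The homomorphism out of the word algebra\<close>

definition word_map :: "('r, 'm) ring_scheme \<Rightarrow> ('r, 'a, 'n) module_scheme \<Rightarrow> nat \<Rightarrow>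
    (nat \<Rightarrow> 'a) \<Rightarrow> (nat \<Rightarrow> 'r) \<Rightarrow> 'a" where
  "word_map R A N y c =
     (\<Oplus>\<^bsub>A\<^esub>n\<in>{n. c n \<noteq> \<zero>\<^bsub>R\<^esub>}. c n \<odot>\<^bsub>A\<^esub> word_eval N (\<otimes>\<^bsub>A\<^esub>) y n)"

context commutative_algebra
begin

lemma mult_comm:
  assumes "u \<in> carrier A" "v \<in> carrier A"
  shows "u \<otimes>\<^bsub>A\<^esub> v = v \<otimes>\<^bsub>A\<^esub> u"
proof -
  have "u \<otimes>\<^bsub>A\<^esub> v = \<ominus>\<^bsub>A\<^esub> (\<ominus>\<^bsub>A\<^esub> (v \<otimes>\<^bsub>A\<^esub> u))"
    using mult_commute[OF assms] mult_closed assms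
    by (intro M.minus_equality[symmetric]) (simp_all add: M.minus_eq)
  then show ?thesis using mult_closed assms by simp
qed

lemma mult_zero_left: "v \<in> carrier A \<Longrightarrow> \<zero>\<^bsub>A\<^esub> \<otimes>\<^bsub>A\<^esub> v = \<zero>\<^bsub>A\<^esub>"
  using mult_smult_left[of \<zero> "\<zero>\<^bsub>A\<^esub>" v] by (simp add: mult_closed)

context
  fixes N :: nat and y :: "nat \<Rightarrow> 'c"
  assumes N: "N > 0" and y: "y \<in> {..<N} \<rightarrow> carrier A"
begin

abbreviation (input) "ev \<equiv> word_eval N (\<otimes>\<^bsub>A\<^esub>) y"
abbreviation (input) "\<Phi> \<equiv> word_map R A N y"
abbreviation (input) "L \<equiv> word_algebra R N"

lemma word_eval_closed [simp]: "ev n \<in> carrier A"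
  using N by (induction n rule: word_induct)
    (use y in \<open>auto simp: word_eval_letter word_eval_product[OF N] mult_closed min_def max_def\<close>)

lemma word_eval_prod: "ev (word_prod N i j) = ev i \<otimes>\<^bsub>A\<^esub> ev j"
  by (auto simp: word_eval_product[OF N] min_def max_def mult_comm)

lemma word_map_eq_finsum:
  assumes "\<And>n. c n \<in> carrier R" "finite S" "{n. c n \<noteq> \<zero>} \<subseteq> S"
  shows "\<Phi> c = (\<Oplus>\<^bsub>A\<^esub>n\<in>S. c n \<odot>\<^bsub>A\<^esub> ev n)"
  unfolding word_map_def
  by (rule M.add.finprod_mono_neutral_cong_left) (use assms in auto)

lemma word_map_zero [simp]: "\<Phi> (\<lambda>n. \<zero>) = \<zero>\<^bsub>A\<^esub>"
  by (simp add: word_map_def)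

lemma word_map_closed:
  assumes "c \<in> carrier L" shows "\<Phi> c \<in> carrier A"
  unfolding word_map_def
  by (rule M.finsum_closed) (use assms in \<open>auto simp: word_algebra_carrier\<close>)

lemma word_map_add:
  assumes "c \<in> carrier L" "d \<in> carrier L"
  shows "\<Phi> (\<lambda>n. c n \<oplus> d n) = \<Phi> c \<oplus>\<^bsub>A\<^esub> \<Phi> d"
proof -
  let ?S = "{n. c n \<noteq> \<zero>} \<union> {n. d n \<noteq> \<zero>}"
  have cl: "\<And>n. c n \<in> carrier R" "\<And>n. d n \<in> carrier R" and fin: "finite ?S"
    using assms by (auto simp: word_algebra_carrier)
  have "\<Phi> (\<lambda>n. c n \<oplus> d n) = (\<Oplus>\<^bsub>A\<^esub>n\<in>?S. (c n \<oplus> d n) \<odot>\<^bsub>A\<^esub> ev n)"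
    by (rule word_map_eq_finsum) (use cl fin in auto)
  also have "\<dots> = (\<Oplus>\<^bsub>A\<^esub>n\<in>?S. c n \<odot>\<^bsub>A\<^esub> ev n \<oplus>\<^bsub>A\<^esub> d n \<odot>\<^bsub>A\<^esub> ev n)"
    by (rule M.finsum_cong') (auto simp: cl smult_l_distr)
  also have "\<dots> = (\<Oplus>\<^bsub>A\<^esub>n\<in>?S. c n \<odot>\<^bsub>A\<^esub> ev n) \<oplus>\<^bsub>A\<^esub> (\<Oplus>\<^bsub>A\<^esub>n\<in>?S. d n \<odot>\<^bsub>A\<^esub> ev n)"
    by (rule M.finsum_addf) (auto simp: cl)
  also have "(\<Oplus>\<^bsub>A\<^esub>n\<in>?S. c n \<odot>\<^bsub>A\<^esub> ev n) = \<Phi> c"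
    by (rule word_map_eq_finsum[symmetric]) (use cl fin in auto)
  also have "(\<Oplus>\<^bsub>A\<^esub>n\<in>?S. d n \<odot>\<^bsub>A\<^esub> ev n) = \<Phi> d"
    by (rule word_map_eq_finsum[symmetric]) (use cl fin in auto)
  finally show ?thesis .
qed

lemma word_map_smult:
  assumes "a \<in> carrier R" "c \<in> carrier L"
  shows "\<Phi> (\<lambda>n. a \<otimes> c n) = a \<odot>\<^bsub>A\<^esub> \<Phi> c"
proof -
  let ?S = "{n. c n \<noteq> \<zero>}"
  have cl: "\<And>n. c n \<in> carrier R" and fin: "finite ?S"
    using assms by (auto simp: word_algebra_carrier)
  have "\<Phi> (\<lambda>n. a \<otimes> c n) = (\<Oplus>\<^bsub>A\<^esub>n\<in>?S. (a \<otimes> c n) \<odot>\<^bsub>A\<^esub> ev n)"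
    by (rule word_map_eq_finsum) (use cl fin assms in auto)
  also have "\<dots> = (\<Oplus>\<^bsub>A\<^esub>n\<in>?S. a \<odot>\<^bsub>A\<^esub> (c n \<odot>\<^bsub>A\<^esub> ev n))"
    by (rule M.finsum_cong') (auto simp: cl assms smult_assoc1)
  also have "\<dots> = a \<odot>\<^bsub>A\<^esub> (\<Oplus>\<^bsub>A\<^esub>n\<in>?S. c n \<odot>\<^bsub>A\<^esub> ev n)"
    by (rule finsum_smult_ldistr[symmetric]) (use cl fin assms in auto)
  finally show ?thesis by (simp add: word_map_def)
qed

lemma word_map_word_vec: "\<Phi> (word_vec R n) = ev n"
proof -
  have "\<Phi> (word_vec R n) = (\<Oplus>\<^bsub>A\<^esub>k\<in>{n}. word_vec R n k \<odot>\<^bsub>A\<^esub> ev k)"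
    by (rule word_map_eq_finsum) (auto simp: word_vec_def)
  also have "\<dots> = ev n"
    by (simp add: word_vec_def)
  finally show ?thesis .
qed

lemma word_map_add_word:
  assumes "a \<in> carrier R" "c \<in> carrier L"
  shows "\<Phi> (\<lambda>k. a \<otimes> word_vec R n k \<oplus> c k) = a \<odot>\<^bsub>A\<^esub> ev n \<oplus>\<^bsub>A\<^esub> \<Phi> c"
  using assms
  by (simp add: word_map_add[OF R.word_algebra_smult_closed] word_map_smult word_map_word_vec)

text \<open>By bilinearity the claim reduces to pairs of words, where it is \<open>word_eval_prod\<close>. One induction
  for each factor performs the reduction.\<close>

lemma word_map_mult:
  assumes "c \<in> carrier L" "d \<in> carrier L"
  shows "\<Phi> (coeff_mult R N c d) = \<Phi> c \<otimes>\<^bsub>A\<^esub> \<Phi> d"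
proof -
  interpret L: commutative_algebra R L by (rule R.word_algebra_commutative_algebra)
  have word_left: "\<Phi> (word_vec R i \<otimes>\<^bsub>L\<^esub> d) = ev i \<otimes>\<^bsub>A\<^esub> \<Phi> d" if "d \<in> carrier L" for i d
    using that
  proof (induction d rule: R.word_algebra_induct)
    case zero
    have "word_vec R i \<otimes>\<^bsub>L\<^esub> \<zero>\<^bsub>L\<^esub> = \<zero>\<^bsub>L\<^esub>"
      using L.mult_comm L.mult_zero_left by (metis L.M.zero_closed R.word_vec_in_algebra)
    then show ?case
      using mult_comm[of "ev i" "\<zero>\<^bsub>A\<^esub>"] by (simp add: mult_zero_left)
  next
    case (add a n d)
    have "word_vec R i \<otimes>\<^bsub>L\<^esub> ((a \<odot>\<^bsub>L\<^esub> word_vec R n) \<oplus>\<^bsub>L\<^esub> d)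
        = (a \<odot>\<^bsub>L\<^esub> (word_vec R i \<otimes>\<^bsub>L\<^esub> word_vec R n)) \<oplus>\<^bsub>L\<^esub> (word_vec R i \<otimes>\<^bsub>L\<^esub> d)"
      using add(1,2) by (simp add: L.mult_add_right L.mult_smult_right del: word_algebra_simps)
    then have "\<Phi> (word_vec R i \<otimes>\<^bsub>L\<^esub> (\<lambda>k. a \<otimes> word_vec R n k \<oplus> d k))
        = a \<odot>\<^bsub>A\<^esub> ev (word_prod N i n) \<oplus>\<^bsub>A\<^esub> \<Phi> (word_vec R i \<otimes>\<^bsub>L\<^esub> d)"
      using add(1,2)
      by (simp add: R.coeff_mult_word_vec R.word_algebra_mult_closed word_map_add_word)
    then show ?case
      using add by (simp add: word_eval_prod word_map_add_word word_map_closed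
          mult_add_right mult_smult_right mult_closed)
  qed
  from assms(1) show ?thesis
  proof (induction c rule: R.word_algebra_induct)
    case zero
    have "\<zero>\<^bsub>L\<^esub> \<otimes>\<^bsub>L\<^esub> d = \<zero>\<^bsub>L\<^esub>"
      by (rule L.mult_zero_left[OF assms(2)])
    then show ?case
      by (simp add: mult_zero_left word_map_closed assms)
  next
    case (add a n c)
    have "((a \<odot>\<^bsub>L\<^esub> word_vec R n) \<oplus>\<^bsub>L\<^esub> c) \<otimes>\<^bsub>L\<^esub> d
        = (a \<odot>\<^bsub>L\<^esub> (word_vec R n \<otimes>\<^bsub>L\<^esub> d)) \<oplus>\<^bsub>L\<^esub> (c \<otimes>\<^bsub>L\<^esub> d)"
      using add(1,2) assms(2)
      by (simp add: L.mult_add_left L.mult_smult_left del: word_algebra_simps)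
    then have "\<Phi> (coeff_mult R N (\<lambda>k. a \<otimes> word_vec R n k \<oplus> c k) d)
        = a \<odot>\<^bsub>A\<^esub> (ev n \<otimes>\<^bsub>A\<^esub> \<Phi> d) \<oplus>\<^bsub>A\<^esub> (\<Phi> c \<otimes>\<^bsub>A\<^esub> \<Phi> d)"
      using add assms(2) word_left[OF assms(2)]
      by (simp add: R.word_algebra_mult_closed word_map_add[OF R.word_algebra_smult_closed]
          word_map_smult)
    then show ?case
      using add(1,2) assms(2)
      by (simp add: word_map_add_word word_map_closed mult_add_left mult_smult_left mult_closed)
  qed
qed

lemma word_map_range_subalgebra: "subalgebra (\<Phi> ` carrier L) R A"
  unfolding subalgebra_def
proof (intro conjI ballI)
  show "submodule (\<Phi> ` carrier L) R A"
  proof (rule submoduleI)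
    show "\<Phi> ` carrier L \<subseteq> carrier A" using word_map_closed by auto
    have "(\<lambda>n. \<zero>) \<in> carrier L" by (simp add: word_algebra_carrier)
    then show "\<zero>\<^bsub>A\<^esub> \<in> \<Phi> ` carrier L" using word_map_zero by force
  next
    fix u v assume "u \<in> \<Phi> ` carrier L" "v \<in> \<Phi> ` carrier L"
    then show "u \<oplus>\<^bsub>A\<^esub> v \<in> \<Phi> ` carrier L"
      using word_map_add R.word_algebra_add_closed by (smt (verit) image_iff)
  next
    show smult: "a \<odot>\<^bsub>A\<^esub> u \<in> \<Phi> ` carrier L" if "a \<in> carrier R" "u \<in> \<Phi> ` carrier L" for a u
      using that word_map_smult R.word_algebra_smult_closed by (smt (verit) image_iff)
    fix u assume u: "u \<in> \<Phi> ` carrier L"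
    then have "u \<in> carrier A" using word_map_closed by auto
    then have "\<ominus>\<^bsub>A\<^esub> u = (\<ominus> \<one>) \<odot>\<^bsub>A\<^esub> u"
      by (simp add: smult_l_minus)
    then show "\<ominus>\<^bsub>A\<^esub> u \<in> \<Phi> ` carrier L" using smult[OF _ u] by simp
  qed
  fix u v assume "u \<in> \<Phi> ` carrier L" "v \<in> \<Phi> ` carrier L"
  then show "u \<otimes>\<^bsub>A\<^esub> v \<in> \<Phi> ` carrier L"
    using word_map_mult R.word_algebra_mult_closed by (smt (verit) image_iff)
qed

text \<open>This is minimality of the range of \<open>\<Phi>\<close>, which identifies it with the generated subalgebra.\<close>

lemma word_map_in_subalgebra:
  assumes S: "subalgebra S R A" and yS: "\<And>i. i < N \<Longrightarrow> y i \<in> S" and c: "c \<in> carrier L"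
  shows "\<Phi> c \<in> S"
proof -
  have sub: "submodule S R A" and mult: "\<And>u v. u \<in> S \<Longrightarrow> v \<in> S \<Longrightarrow> u \<otimes>\<^bsub>A\<^esub> v \<in> S"
    using S by (auto simp: subalgebra_def)
  have "ev n \<in> S" for n
    using N by (induction n rule: word_induct) (simp_all add: word_eval_letter word_eval_prod yS mult)
  moreover have "\<zero>\<^bsub>A\<^esub> \<in> S"
    using submodule.axioms(1)[OF sub] subgroup.one_closed by fastforce
  ultimately show ?thesis
    by (intro R.word_algebra_induct[where P = "\<lambda>c. \<Phi> c \<in> S", OF c])
      (simp_all add: word_map_add_word submoduleE(4,5)[OF sub])
qed

lemma generated_subalgebra_eq_range:
  "generated_subalgebra R A (y ` {..<N}) = A\<lparr>carrier := \<Phi> ` carrier L\<rparr>"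
proof -
  have "y i \<in> \<Phi> ` carrier L" if "i < N" for i
    using that word_map_word_vec[of i] by (metis R.word_vec_in_algebra image_eqI word_eval_letter)
  then have "\<Inter>{S. subalgebra S R A \<and> y ` {..<N} \<subseteq> S} = \<Phi> ` carrier L"
    using word_map_in_subalgebra word_map_range_subalgebra by (intro equalityI) blast+
  then show ?thesis by (simp add: generated_subalgebra_def)
qed

end

lemma subalgebra_commutative_algebra:
  assumes "subalgebra S R A"
  shows "commutative_algebra R (A\<lparr>carrier := S\<rparr>)"
proof -
  have sub: "submodule S R A" and mult: "\<And>u v. u \<in> S \<Longrightarrow> v \<in> S \<Longrightarrow> u \<otimes>\<^bsub>A\<^esub> v \<in> S"
    using assms by (auto simp: subalgebra_def)
  have in_A: "u \<in> S \<Longrightarrow> u \<in> carrier A" for u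
    using submoduleE(1)[OF sub] by blast
  interpret S: module R "A\<lparr>carrier := S\<rparr>"
    by (rule submodule.submodule_is_module[OF sub]) (rule module_axioms)
  show ?thesis
  proof (intro commutative_algebra.intro nonassoc_algebra.intro nonassoc_algebra_axioms.intro
      commutative_algebra_axioms.intro R.field_axioms S.module_axioms)
    fix u v assume uv: "u \<in> carrier (A\<lparr>carrier := S\<rparr>)" "v \<in> carrier (A\<lparr>carrier := S\<rparr>)"
    have "u \<otimes>\<^bsub>A\<^esub> v = v \<otimes>\<^bsub>A\<^esub> u" using uv in_A by (simp add: mult_comm)
    then show "u \<otimes>\<^bsub>A\<lparr>carrier := S\<rparr>\<^esub> v \<ominus>\<^bsub>A\<lparr>carrier := S\<rparr>\<^esub> v \<otimes>\<^bsub>A\<lparr>carrier := S\<rparr>\<^esub> u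
        = \<zero>\<^bsub>A\<lparr>carrier := S\<rparr>\<^esub>"
      using S.M.r_neg[of "u \<otimes>\<^bsub>A\<^esub> v"] mult uv by (simp add: a_minus_def)
  qed (auto simp: in_A mult mult_add_left mult_add_right mult_smult_left mult_smult_right)
qed

text \<open>An injective \<open>\<Phi>\<close> identifies the subalgebra generated by the \<open>y i\<close> with the word algebra. The
  homomorphism to a test algebra \<open>B\<close> is then \<open>\<Psi> \<circ> \<Phi>\<^sup>-\<^sup>1\<close>, with \<open>\<Psi>\<close> the corresponding map from the word
  algebra to \<open>B\<close>; any other one agrees with it on the values of words, which span.\<close>

lemma free_if_word_map_injective:
  assumes N: "N > 0" and y: "y \<in> {..<N} \<rightarrow> carrier A"
    and inj: "inj_on (word_map R A N y) (carrier (word_algebra R N))"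
    and inj_y: "inj_on y {..<N}"
  shows "free_commutative_algebra TYPE('t) R (generated_subalgebra R A (y ` {..<N})) (y ` {..<N})"
proof -
  let ?L = "word_algebra R N" and ?\<Phi> = "word_map R A N y"
  let ?G = "generated_subalgebra R A (y ` {..<N})"
  have G: "?G = A\<lparr>carrier := ?\<Phi> ` carrier ?L\<rparr>"
    by (rule generated_subalgebra_eq_range[OF N y])
  have sub: "subalgebra (?\<Phi> ` carrier ?L) R A"
    by (rule word_map_range_subalgebra[OF N y])
  have vec: "?\<Phi> (word_vec R i) = y i" if "i < N" for i
    using word_map_word_vec[OF N y] that by (simp add: word_eval_letter)
  show ?thesis
    unfolding free_commutative_algebra_def
  proof (intro conjI allI impI ballI)
    show "commutative_algebra R ?G"
      unfolding G by (rule subalgebra_commutative_algebra[OF sub])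
    show "y ` {..<N} \<subseteq> carrier ?G"
      using vec by (auto simp: G image_iff) (metis R.word_vec_in_algebra)
    fix B :: "('a, 't) module" and f
    assume "commutative_algebra R B" and f: "f \<in> y ` {..<N} \<rightarrow> carrier B"
    interpret B: commutative_algebra R B by fact
    have z: "(\<lambda>i. f (y i)) \<in> {..<N} \<rightarrow> carrier B" using f by auto
    let ?\<Psi> = "word_map R B N (\<lambda>i. f (y i))"
    define h where "h = restrict (\<lambda>u. ?\<Psi> (inv_into (carrier ?L) ?\<Phi> u)) (carrier ?G)"
    have h: "h (?\<Phi> c) = ?\<Psi> c" if "c \<in> carrier ?L" for c
      using that inj by (simp add: h_def G)
    have hom: "h \<in> algebra_hom R ?G B"
    proof -
      have "h (?\<Phi> c \<oplus>\<^bsub>A\<^esub> ?\<Phi> d) = h (?\<Phi> c) \<oplus>\<^bsub>B\<^esub> h (?\<Phi> d)"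
        if "c \<in> carrier ?L" "d \<in> carrier ?L" for c d
        using that R.word_algebra_add_closed
        by (simp add: h B.word_map_add[OF N z] word_map_add[OF N y, symmetric])
      moreover have "h (?\<Phi> c \<otimes>\<^bsub>A\<^esub> ?\<Phi> d) = h (?\<Phi> c) \<otimes>\<^bsub>B\<^esub> h (?\<Phi> d)"
        if "c \<in> carrier ?L" "d \<in> carrier ?L" for c d
        using that R.word_algebra_mult_closed
        by (simp add: h B.word_map_mult[OF N z] word_map_mult[OF N y, symmetric])
      moreover have "h (a \<odot>\<^bsub>A\<^esub> ?\<Phi> c) = a \<odot>\<^bsub>B\<^esub> h (?\<Phi> c)"
        if "a \<in> carrier R" "c \<in> carrier ?L" for a c
        using that R.word_algebra_smult_closed
        by (simp add: h B.word_map_smult[OF N z] word_map_smult[OF N y, symmetric])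
      moreover have "h (?\<Phi> c) \<in> carrier B" if "c \<in> carrier ?L" for c
        using that by (simp add: h B.word_map_closed[OF N z])
      ultimately show ?thesis
        by (auto simp: algebra_hom_def G)
    qed
    show "\<exists>!h. h \<in> algebra_hom R ?G B \<and> h \<in> extensional (carrier ?G) \<and>
        (\<forall>u\<in>y ` {..<N}. h u = f u)"
    proof (intro ex1I conjI)
      show "h \<in> algebra_hom R ?G B" by (rule hom)
      show "h \<in> extensional (carrier ?G)" by (simp add: h_def)
      show "\<forall>u\<in>y ` {..<N}. h u = f u"
      proof clarsimp
        fix i assume "i < N"
        then show "h (y i) = f (y i)"
          using h[of "word_vec R i"] vec B.word_map_word_vec[OF N z]
          by (simp add: word_eval_letter)
      qed
      fix g assume g: "g \<in> algebra_hom R ?G B \<and> g \<in> extensional (carrier ?G) \<and>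
        (\<forall>u\<in>y ` {..<N}. g u = f u)"
      let ?ev = "word_eval N (\<otimes>\<^bsub>A\<^esub>) y" and ?evB = "word_eval N (\<otimes>\<^bsub>B\<^esub>) (\<lambda>i. f (y i))"
      have ev_G: "?ev n \<in> ?\<Phi> ` carrier ?L" for n
        unfolding word_map_word_vec[OF N y, symmetric] by (rule imageI) (rule R.word_vec_in_algebra)
      have g_add: "\<And>u v. u \<in> ?\<Phi> ` carrier ?L \<Longrightarrow> v \<in> ?\<Phi> ` carrier ?L \<Longrightarrow>
            g (u \<oplus>\<^bsub>A\<^esub> v) = g u \<oplus>\<^bsub>B\<^esub> g v"
        and g_mult: "\<And>u v. u \<in> ?\<Phi> ` carrier ?L \<Longrightarrow> v \<in> ?\<Phi> ` carrier ?L \<Longrightarrow>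
            g (u \<otimes>\<^bsub>A\<^esub> v) = g u \<otimes>\<^bsub>B\<^esub> g v"
        and g_smult: "\<And>a u. a \<in> carrier R \<Longrightarrow> u \<in> ?\<Phi> ` carrier ?L \<Longrightarrow>
            g (a \<odot>\<^bsub>A\<^esub> u) = a \<odot>\<^bsub>B\<^esub> g u"
        and g_closed: "\<And>u. u \<in> ?\<Phi> ` carrier ?L \<Longrightarrow> g u \<in> carrier B"
        using conjunct1[OF g] unfolding algebra_hom_def G by auto
      have g_ev: "g (?ev n) = ?evB n" for n
        using N
      proof (induction n rule: word_induct)
        case (letter i)
        then show ?case using conjunct2[OF conjunct2[OF g]] by (simp add: word_eval_letter)
      next
        case (product i j)
        then show ?case
          using g_mult ev_G by (simp add: word_eval_prod[OF N y] B.word_eval_prod[OF N z])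
      qed
      have g_zero: "g \<zero>\<^bsub>A\<^esub> = \<zero>\<^bsub>B\<^esub>"
        using g_smult[of \<zero> "?ev 0"] ev_G[of 0] g_closed[of "?ev 0"] word_eval_closed[OF N y, of 0]
        by simp
      have g_map: "g (?\<Phi> c) = ?\<Psi> c" if "c \<in> carrier ?L" for c
        using that
      proof (induction c rule: R.word_algebra_induct)
        case zero
        then show ?case by (simp add: g_zero word_map_zero[OF N y] B.word_map_zero[OF N z])
      next
        case (add a n c)
        have "a \<odot>\<^bsub>A\<^esub> ?ev n \<in> ?\<Phi> ` carrier ?L"
          using sub ev_G add(1) submoduleE(4) by (auto simp: subalgebra_def)
        with add show ?case
          using ev_G
          by (simp add: word_map_add_word[OF N y] B.word_map_add_word[OF N z] g_add g_smult g_ev)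
      qed
      show "g = h"
      proof (rule extensionalityI)
        show "g \<in> extensional (carrier ?G)" by (rule conjunct1[OF conjunct2[OF g]])
        show "h \<in> extensional (carrier ?G)" by (simp add: h_def)
        show "g u = h u" if "u \<in> carrier ?G" for u
          using that h g_map by (auto simp: G)
      qed
    qed
  qed
qed

end


section \<open>Nonzero ideals meet the word algebra over a subfield\<close>

text \<open>The element \<open>c (U x) - (c U) x\<close>, with the subtraction written as addition of a multiple by
  \<open>-1\<close>, so that it is formed by the operations under which an ideal is assumed to be closed.\<close>

definition exchange ::
  "('r, 'm) ring_scheme \<Rightarrow> nat \<Rightarrow> nat \<Rightarrow> (nat \<Rightarrow> 'r) \<Rightarrow> (nat \<Rightarrow> 'r) \<Rightarrow> nat \<Rightarrow> 'r" where
  "exchange R N U c x = (\<lambda>n.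
     coeff_mult R N c (coeff_mult R N (word_vec R U) x) n
       \<oplus>\<^bsub>R\<^esub> (\<ominus>\<^bsub>R\<^esub> \<one>\<^bsub>R\<^esub> \<otimes>\<^bsub>R\<^esub> coeff_mult R N (coeff_mult R N c (word_vec R U)) x n))"

context field
begin

lemma exchange_self:
  assumes "\<And>n. c n \<in> carrier R"
  shows "exchange R N U c c = (\<lambda>n. \<zero>)"
proof -
  have "coeff_mult R N (word_vec R U) c = coeff_mult R N c (word_vec R U)"
    by (rule coeff_mult_commute) (simp_all add: assms)
  moreover have "coeff_mult R N c (coeff_mult R N c (word_vec R U))
      = coeff_mult R N (coeff_mult R N c (word_vec R U)) c"
    by (rule coeff_mult_commute) (simp_all add: assms coeff_mult_in_carrier)
  ultimately show ?thesis
    by (simp add: exchange_def l_minus r_neg assms coeff_mult_in_carrier)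
qed

lemma exchange_in_carrier:
  assumes "\<And>n. c n \<in> carrier R" "\<And>n. x n \<in> carrier R"
  shows "exchange R N U c x n \<in> carrier R"
  by (simp add: exchange_def assms coeff_mult_in_carrier)

lemma exchange_finsum:
  assumes J: "finite J" and c: "\<And>n. c n \<in> carrier R"
    and a: "\<And>i n. i \<in> J \<Longrightarrow> a i n \<in> carrier R" and f: "\<And>i. i \<in> J \<Longrightarrow> f i \<in> carrier R"
  shows "exchange R N U c (\<lambda>n. \<Oplus>i\<in>J. f i \<otimes> a i n) n = (\<Oplus>i\<in>J. f i \<otimes> exchange R N U c (a i) n)"
proof -
  let ?u = "word_vec R U"
  have linear: "coeff_mult R N d (\<lambda>n. \<Oplus>i\<in>J. f i \<otimes> b i n)
      = (\<lambda>n. \<Oplus>i\<in>J. f i \<otimes> coeff_mult R N d (b i) n)"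
    if "\<And>n. d n \<in> carrier R" "\<And>i n. i \<in> J \<Longrightarrow> b i n \<in> carrier R" for d b
  proof -
    have "coeff_mult R N d (\<lambda>n. \<Oplus>i\<in>J. f i \<otimes> b i n)
        = (\<lambda>n. \<Oplus>i\<in>J. coeff_mult R N d (\<lambda>n. f i \<otimes> b i n) n)"
      by (rule coeff_mult_finsum) (use J f that in auto)
    also have "\<dots> = (\<lambda>n. \<Oplus>i\<in>J. f i \<otimes> coeff_mult R N d (b i) n)"
      by (rule ext, rule finsum_cong') (use f that in \<open>auto simp: coeff_mult_smult coeff_mult_in_carrier\<close>)
    finally show ?thesis .
  qed
  let ?p = "\<lambda>i. coeff_mult R N c (coeff_mult R N ?u (a i))"
  let ?q = "\<lambda>i. coeff_mult R N (coeff_mult R N c ?u) (a i)"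
  have p: "?p i n \<in> carrier R" and q: "?q i n \<in> carrier R" if "i \<in> J" for i
    using that c a by (simp_all add: coeff_mult_in_carrier)
  have "exchange R N U c (\<lambda>n. \<Oplus>i\<in>J. f i \<otimes> a i n) n
      = (\<Oplus>i\<in>J. f i \<otimes> ?p i n) \<oplus> (\<ominus> \<one> \<otimes> (\<Oplus>i\<in>J. f i \<otimes> ?q i n))"
    using c a by (simp add: exchange_def linear coeff_mult_in_carrier)
  also have "\<dots> = (\<Oplus>i\<in>J. f i \<otimes> ?p i n) \<oplus> (\<Oplus>i\<in>J. \<ominus> \<one> \<otimes> (f i \<otimes> ?q i n))"
    using J f q by (subst finsum_rdistr) auto
  also have "\<dots> = (\<Oplus>i\<in>J. f i \<otimes> ?p i n \<oplus> \<ominus> \<one> \<otimes> (f i \<otimes> ?q i n))"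
    using f p q by (intro finsum_addf[symmetric]) auto
  also have "\<dots> = (\<Oplus>i\<in>J. f i \<otimes> exchange R N U c (a i) n)"
    using f p q by (intro finsum_cong') (auto simp: exchange_def r_distr m_lcomm)
  finally show ?thesis .
qed

text \<open>The word \<open>W = m' U\<close> is larger than \<open>U\<close>, hence outside the supports of \<open>c\<close> and \<open>x\<close>. So of the two
  ways to split \<open>m W\<close> between the factors of a product, only the one that assigns \<open>W\<close> to the factor
  containing \<open>U\<close> contributes, and likewise for \<open>m' U\<close>.\<close>

lemma exchange_coeff:
  assumes N: "N > 0" and c: "\<And>n. c n \<in> carrier R" and x: "\<And>n. x n \<in> carrier R"
    and cU: "\<And>n. n \<ge> U \<Longrightarrow> c n = \<zero>" and xU: "\<And>n. n \<ge> U \<Longrightarrow> x n = \<zero>"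
    and "m < U" "m' < U"
  shows "exchange R N U c x (word_prod N m (word_prod N m' U)) = (c m \<otimes> x m') \<oplus> \<ominus> (c m' \<otimes> x m)"
proof -
  let ?W = "word_prod N m' U" and ?u = "word_vec R U"
  have W: "U < ?W" by (rule word_prod_greater[OF N])
  then have neq: "m \<noteq> ?W" "m' \<noteq> U" using assms by auto
  have cW: "c ?W = \<zero>" "x ?W = \<zero>" "c U = \<zero>" "x U = \<zero>"
    using W cU xU by auto
  have u: "?u m' = \<zero>" "?u U = \<one>"
    using neq by (simp_all add: word_vec_def)
  have ux: "coeff_mult R N ?u x ?W = x m'"
    using u x cW neq by (simp add: coeff_mult_product)
  have cu: "coeff_mult R N c ?u ?W = c m'"
    using u c cW neq by (simp add: coeff_mult_product)
  have "coeff_mult R N c (coeff_mult R N ?u x) (word_prod N m ?W) = c m \<otimes> x m'"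
    using neq c x cW ux by (simp add: coeff_mult_product coeff_mult_in_carrier)
  moreover have "coeff_mult R N (coeff_mult R N c ?u) x (word_prod N m ?W) = c m' \<otimes> x m"
    using neq c x cW cu by (simp add: coeff_mult_product coeff_mult_in_carrier)
  ultimately show ?thesis
    by (simp add: exchange_def l_minus c x)
qed

text \<open>All minors with the nonzero entry \<open>c m\<close> vanish, so the coefficient vectors of \<open>c\<close> and \<open>x\<close> have
  rank one.\<close>

lemma exchange_zero_imp_proportional:
  assumes N: "N > 0" and c: "\<And>n. c n \<in> carrier R" and x: "\<And>n. x n \<in> carrier R"
    and cU: "\<And>n. n \<ge> U \<Longrightarrow> c n = \<zero>" and xU: "\<And>n. n \<ge> U \<Longrightarrow> x n = \<zero>"
    and zero: "\<And>n. exchange R N U c x n = \<zero>" and m: "c m \<noteq> \<zero>"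
  shows "x n = (x m \<otimes> inv (c m)) \<otimes> c n"
proof (cases "n < U")
  case True
  have "m < U" using m cU not_le by blast
  with True have minor: "(c m \<otimes> x n) \<oplus> \<ominus> (c n \<otimes> x m) = \<zero>"
    using exchange_coeff[of N c x U m n] N c x cU xU zero by simp
  have unit: "c m \<in> Units R" using m c by (simp add: field_Units)
  have "c m \<otimes> x n = c n \<otimes> x m"
    using minor c x minus_equality[of "c m \<otimes> x n" "\<ominus> (c n \<otimes> x m)"] by simp
  then have "inv (c m) \<otimes> (c m \<otimes> x n) = inv (c m) \<otimes> (c n \<otimes> x m)" by simp
  then show ?thesis
    using unit c x by (simp add: m_assoc[symmetric]) (simp add: m_ac)
next
  case False
  then have "x n = \<zero>" "c n = \<zero>" using xU cU by auto
  moreover have "inv (c m) \<in> carrier R"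
    using m c by (simp add: field_Units)
  ultimately show ?thesis using x by simp
qed

lemma finsum_word_vec:
  assumes "finite J" "\<And>i. i \<in> J \<Longrightarrow> k i \<in> carrier R"
  shows "(\<Oplus>i\<in>J. k i \<otimes> word_vec R i n) = (if n \<in> J then k n else \<zero>)"
proof -
  have "(\<Oplus>i\<in>J. k i \<otimes> word_vec R i n) = (\<Oplus>i\<in>J. if n = i then k i else \<zero>)"
    by (rule finsum_cong') (auto simp: word_vec_def assms)
  also have "\<dots> = (if n \<in> J then k n else \<zero>)"
  proof (cases "n \<in> J")
    case True
    then show ?thesis using assms by (simp add: finsum_singleton)
  next
    case False
    then have "(\<Oplus>i\<in>J. if n = i then k i else \<zero>) = (\<Oplus>i\<in>J. \<zero>)"
      by (intro finsum_cong') auto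
    with False show ?thesis by simp
  qed
  finally show ?thesis .
qed

text \<open>The induction on the number of terms. Stating it for arbitrary \<open>K\<close>-independent elements
  \<open>a i\<close>, not just for words, is what makes it go through: after one exchange step the words have
  turned into combinations of words.\<close>

lemma ideal_combination_trivial:
  assumes N: "N > 0" and K: "subfield K R"
    and add: "\<And>c d. c \<in> I \<Longrightarrow> d \<in> I \<Longrightarrow> (\<lambda>n. c n \<oplus> d n) \<in> I"
    and smult: "\<And>a c. a \<in> carrier R \<Longrightarrow> c \<in> I \<Longrightarrow> (\<lambda>n. a \<otimes> c n) \<in> I"
    and absorb: "\<And>c d. c \<in> carrier (word_algebra R N) \<Longrightarrow> d \<in> I \<Longrightarrow> coeff_mult R N c d \<in> I"
    and trivial: "\<And>c. c \<in> I \<Longrightarrow> c \<in> carrier (word_algebra (R\<lparr>carrier := K\<rparr>) N) \<Longrightarrow> c = (\<lambda>n. \<zero>)"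
    and J: "finite J"
    and a: "\<And>i. i \<in> J \<Longrightarrow> a i \<in> carrier (word_algebra (R\<lparr>carrier := K\<rparr>) N)"
    and indep: "\<And>k i. (\<And>i. i \<in> J \<Longrightarrow> k i \<in> K) \<Longrightarrow> (\<And>n. (\<Oplus>i\<in>J. k i \<otimes> a i n) = \<zero>) \<Longrightarrow>
          i \<in> J \<Longrightarrow> k i = \<zero>"
    and f: "\<And>i. i \<in> J \<Longrightarrow> f i \<in> carrier R"
    and comb: "(\<lambda>n. \<Oplus>i\<in>J. f i \<otimes> a i n) \<in> I"
  shows "\<forall>i\<in>J. f i = \<zero>"
  using J a indep f comb
proof (induction J arbitrary: a rule: finite_induct)
  case empty
  then show ?case by simp
next
  case (insert i0 J)
  let ?LK = "word_algebra (R\<lparr>carrier := K\<rparr>) N"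
  interpret K: field "R\<lparr>carrier := K\<rparr>" by (rule subfield_iff(2)[OF K])
  have KR: "K \<subseteq> carrier R" by (rule subfieldE(3)[OF K])
  have subring: "subring K R" by (rule subfieldE(1)[OF K])
  have LK: "(\<forall>n. c n \<in> K) \<and> finite {n. c n \<noteq> \<zero>}" if "c \<in> carrier ?LK" for c
    using that by (simp add: word_algebra_carrier)
  have a_K: "a i n \<in> K" and a_R: "a i n \<in> carrier R" if "i \<in> insert i0 J" for i n
    using LK[OF insert.prems(1)[OF that]] KR by auto
  \<comment> \<open>The term indexed by \<open>i0\<close> is the one to be eliminated.\<close>
  define c where "c = a i0"
  have c_LK: "c \<in> carrier ?LK" and c_K: "\<And>n. c n \<in> K" and c_R: "\<And>n. c n \<in> carrier R"
    using insert.prems(1) a_K a_R by (auto simp: c_def)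
  have c_L: "c \<in> carrier (word_algebra R N)"
    using LK[OF c_LK] KR by (auto simp: word_algebra_carrier)
  have "finite (\<Union>i\<in>insert i0 J. {n. a i n \<noteq> \<zero>})"
    using insert.hyps(1) LK[OF insert.prems(1)] by blast
  then obtain U where below_U: "(\<Union>i\<in>insert i0 J. {n. a i n \<noteq> \<zero>}) \<subseteq> {..<U}"
    using finite_nat_iff_bounded by blast
  have U: "a i n = \<zero>" if "i \<in> insert i0 J" "n \<ge> U" for i n
  proof (rule ccontr)
    assume "a i n \<noteq> \<zero>"
    with that(1) have "n \<in> {..<U}" by (intro subsetD[OF below_U]) blast
    with that(2) show False by simp
  qed
  define b where "b i = exchange R N U c (a i)" for i
  have split: "(\<Oplus>i\<in>insert i0 J. g i) = g i0 \<oplus> (\<Oplus>i\<in>J. g i)"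
    if "\<And>i. i \<in> insert i0 J \<Longrightarrow> g i \<in> carrier R" for g
    using that insert.hyps by (intro finsum_insert) auto
  have "\<exists>m. c m \<noteq> \<zero>"
  proof (rule ccontr)
    assume "\<nexists>m. c m \<noteq> \<zero>"
    then have c0: "\<And>n. a i0 n = \<zero>" by (simp add: c_def)
    define k where "k i = (if i = i0 then \<one> else \<zero>)" for i
    have "(\<Oplus>i\<in>insert i0 J. k i \<otimes> a i n) = (\<Oplus>i\<in>insert i0 J. \<zero>)" for n
      by (rule finsum_cong') (use c0 a_R in \<open>auto simp: k_def\<close>)
    then have "(\<Oplus>i\<in>insert i0 J. k i \<otimes> a i n) = \<zero>" for n by simp
    moreover have "k i \<in> K" for i
      using subringE(2,3)[OF subring] by (simp add: k_def)
    ultimately have "k i0 = \<zero>" using insert.prems(2)[of k i0] by blast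
    then show False by (simp add: k_def)
  qed
  then obtain m where m: "c m \<noteq> \<zero>" by blast
  have J_zero: "\<forall>i\<in>J. f i = \<zero>"
  proof (rule insert.IH[of b])
    show "b i \<in> carrier ?LK" if "i \<in> J" for i
    proof -
      have ai: "a i \<in> carrier ?LK" using insert.prems(1) that by blast
      have u: "word_vec R U \<in> carrier ?LK" using K.word_vec_in_algebra by simp
      have "coeff_mult R N c (coeff_mult R N (word_vec R U) (a i)) \<in> carrier ?LK"
        using K.word_algebra_mult_closed c_LK ai u by (metis coeff_mult_subfield)
      moreover have "coeff_mult R N (coeff_mult R N c (word_vec R U)) (a i) \<in> carrier ?LK"
        using K.word_algebra_mult_closed c_LK ai u by (metis coeff_mult_subfield)
      moreover have "\<ominus> \<one> \<in> K"
        using subringE(3,5)[OF subring] by blast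
      ultimately show ?thesis
        using K.word_algebra_add_closed[OF _ K.word_algebra_smult_closed]
        by (simp add: b_def exchange_def)
    qed
    show "k i = \<zero>" if kK: "\<And>i. i \<in> J \<Longrightarrow> k i \<in> K" and zero: "\<And>n. (\<Oplus>i\<in>J. k i \<otimes> b i n) = \<zero>"
      and i: "i \<in> J" for k i
    proof -
      define x where "x n = (\<Oplus>i\<in>J. k i \<otimes> a i n)" for n
      have kR: "\<And>i. i \<in> J \<Longrightarrow> k i \<in> carrier R" using kK KR by blast
      have x_R: "x n \<in> carrier R" for n
        unfolding x_def using kR a_R by (intro finsum_closed) auto
      have x_K: "x n \<in> K" for n
      proof -
        have "(\<Oplus>i\<in>S. k i \<otimes> a i n) \<in> K" if "finite S" "S \<subseteq> J" for S
          using that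
        proof (induction S rule: finite_induct)
          case empty
          then show ?case using subringE(2)[OF subring] by simp
        next
          case (insert j S)
          then have "(\<Oplus>i\<in>insert j S. k i \<otimes> a i n) = k j \<otimes> a j n \<oplus> (\<Oplus>i\<in>S. k i \<otimes> a i n)"
            using kR a_R by (intro finsum_insert) auto
          then show ?case
            using insert kK a_K subringE(6,7)[OF subring] by simp
        qed
        then show ?thesis using insert.hyps(1) by (simp add: x_def)
      qed
      have xU: "x n = \<zero>" if "n \<ge> U" for n
      proof -
        have "x n = (\<Oplus>i\<in>J. \<zero>)"
          unfolding x_def by (rule finsum_cong') (use that U kR in auto)
        then show ?thesis by simp
      qed
      have "exchange R N U c x n = \<zero>" for n
      proof -
        have "exchange R N U c x n = (\<Oplus>i\<in>J. k i \<otimes> b i n)"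
          using exchange_finsum[OF insert.hyps(1) c_R, of a k] a_R kR
          by (simp add: b_def x_def[abs_def])
        then show ?thesis using zero by simp
      qed
      \<comment> \<open>The vanishing of the combination of the \<open>b i\<close> makes \<open>x\<close> a multiple of \<open>c\<close>, and the factor
        lies in \<open>K\<close>: this is a \<open>K\<close>-relation between \<open>a i0\<close> and the other \<open>a i\<close>.\<close>
      then have proportional: "x n = (x m \<otimes> inv (c m)) \<otimes> c n" for n
        using N c_R x_R U[of i0] xU m
        by (intro exchange_zero_imp_proportional[where U = U]) (auto simp: c_def)
      define l where "l = x m \<otimes> inv (c m)"
      have "inv (c m) \<in> K"
        using subfield_m_inv(1)[OF K] m c_K by blast
      then have l_K: "l \<in> K" and l_R: "l \<in> carrier R"
        using x_K subringE(6)[OF subring] KR by (auto simp: l_def)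
      define k' where "k' i = (if i = i0 then \<ominus> l else k i)" for i
      have "(\<Oplus>i\<in>insert i0 J. k' i \<otimes> a i n) = \<zero>" for n
      proof -
        have "(\<Oplus>i\<in>insert i0 J. k' i \<otimes> a i n) = \<ominus> l \<otimes> c n \<oplus> (\<Oplus>i\<in>J. k' i \<otimes> a i n)"
          by (subst split) (use kR l_R a_R in \<open>auto simp: k'_def c_def\<close>)
        also have "(\<Oplus>i\<in>J. k' i \<otimes> a i n) = x n"
          unfolding x_def
          by (rule finsum_cong') (use insert.hyps kR a_R in \<open>auto simp: k'_def\<close>)
        also have "\<ominus> l \<otimes> c n \<oplus> x n = \<zero>"
          using proportional[of n] l_R c_R by (simp add: l_def[symmetric] l_minus l_neg)
        finally show ?thesis .
      qed
      moreover have "k' i \<in> K" if "i \<in> insert i0 J" for i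
        using that kK l_K subringE(5)[OF subring] by (auto simp: k'_def)
      ultimately have "k' i = \<zero>" using insert.prems(2)[of k' i] i by blast
      then show ?thesis using i insert.hyps(2) by (auto simp: k'_def split: if_splits)
    qed
    show "f i \<in> carrier R" if "i \<in> J" for i using insert.prems(3) that by blast
    show "(\<lambda>n. \<Oplus>i\<in>J. f i \<otimes> b i n) \<in> I"
    proof -
      let ?z = "\<lambda>n. \<Oplus>i\<in>insert i0 J. f i \<otimes> a i n"
      have fb: "f i \<otimes> b i n \<in> carrier R" if "i \<in> insert i0 J" for i n
        using that insert.prems(3) a_R c_R by (simp add: b_def exchange_in_carrier)
      have "exchange R N U c ?z n = (\<Oplus>i\<in>insert i0 J. f i \<otimes> b i n)" for n
        unfolding b_def using insert.hyps(1) insert.prems(3) a_R c_R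
        by (intro exchange_finsum) auto
      also have "(\<Oplus>i\<in>insert i0 J. f i \<otimes> b i n) = (\<Oplus>i\<in>J. f i \<otimes> b i n)" for n
        using split[of "\<lambda>i. f i \<otimes> b i n"] fb insert.prems(3) insert.hyps(1)
        by (simp add: b_def exchange_self[OF c_R, folded c_def] c_def[symmetric] finsum_closed Pi_iff)
      finally have "(\<lambda>n. \<Oplus>i\<in>J. f i \<otimes> b i n) = exchange R N U c ?z" by (intro ext) simp
      moreover have "exchange R N U c ?z \<in> I"
        unfolding exchange_def
        using c_L insert.prems(4) word_algebra_mult_closed
        by (intro add smult absorb) auto
      ultimately show ?thesis by simp
    qed
  qed
  moreover have "f i0 = \<zero>"
  proof (rule ccontr)
    assume f0: "f i0 \<noteq> \<zero>"
    have f_R: "f i0 \<in> carrier R" using insert.prems(3) by blast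
    then have unit: "f i0 \<in> Units R" using f0 by (simp add: field_Units)
    have "(\<Oplus>i\<in>insert i0 J. f i \<otimes> a i n) = f i0 \<otimes> c n" for n
    proof -
      have "(\<Oplus>i\<in>J. f i \<otimes> a i n) = (\<Oplus>i\<in>J. \<zero>)"
        by (rule finsum_cong') (use J_zero a_R in auto)
      then show ?thesis
        using split[of "\<lambda>i. f i \<otimes> a i n"] insert.prems(3) a_R f_R c_R by (simp add: c_def)
    qed
    with insert.prems(4) have "(\<lambda>n. f i0 \<otimes> c n) \<in> I" by simp
    then have "(\<lambda>n. inv (f i0) \<otimes> (f i0 \<otimes> c n)) \<in> I"
      using unit smult[of "inv (f i0)" "\<lambda>n. f i0 \<otimes> c n"] by simp
    then have "c \<in> I"
      using unit c_R f_R by (simp add: m_assoc[symmetric])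
    then show False using trivial[OF _ c_LK] m by simp
  qed
  ultimately show ?case by blast
qed

text \<open>An element is a combination of the words in its support, and words are independent.\<close>

theorem ideal_trivial_if_trivial_over_subfield:
  assumes "N > 0" and K: "subfield K R"
    and "\<And>c d. c \<in> I \<Longrightarrow> d \<in> I \<Longrightarrow> (\<lambda>n. c n \<oplus> d n) \<in> I"
    and "\<And>a c. a \<in> carrier R \<Longrightarrow> c \<in> I \<Longrightarrow> (\<lambda>n. a \<otimes> c n) \<in> I"
    and "\<And>c d. c \<in> carrier (word_algebra R N) \<Longrightarrow> d \<in> I \<Longrightarrow> coeff_mult R N c d \<in> I"
    and "\<And>c. c \<in> I \<Longrightarrow> c \<in> carrier (word_algebra (R\<lparr>carrier := K\<rparr>) N) \<Longrightarrow> c = (\<lambda>n. \<zero>)"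
    and c: "c \<in> I" "c \<in> carrier (word_algebra R N)"
  shows "c = (\<lambda>n. \<zero>)"
proof -
  let ?J = "{n. c n \<noteq> \<zero>}"
  interpret K: field "R\<lparr>carrier := K\<rparr>" by (rule subfield_iff(2)[OF K])
  have KR: "K \<subseteq> carrier R" by (rule subfieldE(3)[OF K])
  have c_R: "\<And>n. c n \<in> carrier R" and fin: "finite ?J"
    using c(2) by (simp_all add: word_algebra_carrier)
  have "\<forall>i\<in>?J. c i = \<zero>"
  proof (rule ideal_combination_trivial[OF assms(1-6) fin])
    show "word_vec R i \<in> carrier (word_algebra (R\<lparr>carrier := K\<rparr>) N)" for i
      using K.word_vec_in_algebra by simp
    show "k i = \<zero>" if "\<And>i. i \<in> ?J \<Longrightarrow> k i \<in> K" "\<And>n. (\<Oplus>i\<in>?J. k i \<otimes> word_vec R i n) = \<zero>" "i \<in> ?J"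
      for k i
      using that(2)[of i] that(1,3) KR by (subst (asm) finsum_word_vec[OF fin]) auto
    have "(\<Oplus>i\<in>?J. c i \<otimes> word_vec R i n) = c n" for n
      using c_R by (subst finsum_word_vec[OF fin]) auto
    then show "(\<lambda>n. \<Oplus>i\<in>?J. c i \<otimes> word_vec R i n) \<in> I" using c(1) by simp
  qed (use c_R in auto)
  then show ?thesis by auto
qed

end


section \<open>Passing from a subfield to the field\<close>

text \<open>If the \<open>K\<close>-algebra \<open>S\<close> admits a homomorphism \<open>h\<close> that sends every \<open>y i\<close> back to its letter, then \<open>h\<close>
  recovers each combination of words over \<open>K\<close> from its value in \<open>A\<close>; so \<open>\<Phi>\<close> has no kernel
  there.\<close>

lemma (in commutative_algebra) word_map_retraction_over_subfield:
  assumes K: "subfield K R" and N: "N > 0" and y: "y \<in> {..<N} \<rightarrow> carrier A"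
    and y_S: "y \<in> {..<N} \<rightarrow> S"
    and S: "commutative_algebra (R\<lparr>carrier := K\<rparr>) (A\<lparr>carrier := S\<rparr>)"
    and h: "h \<in> algebra_hom (R\<lparr>carrier := K\<rparr>) (A\<lparr>carrier := S\<rparr>) (word_algebra (R\<lparr>carrier := K\<rparr>) N)"
    and h_y: "\<And>i. i < N \<Longrightarrow> h (y i) = word_vec R i"
    and c: "c \<in> carrier (word_algebra (R\<lparr>carrier := K\<rparr>) N)"
  shows "h (word_map R A N y c) = c"
proof -
  let ?ev = "word_eval N (\<otimes>\<^bsub>A\<^esub>) y" and ?LK = "word_algebra (R\<lparr>carrier := K\<rparr>) N"
  interpret K: field "R\<lparr>carrier := K\<rparr>" by (rule R.subfield_iff(2)[OF K])
  interpret S: commutative_algebra "R\<lparr>carrier := K\<rparr>" "A\<lparr>carrier := S\<rparr>" by (rule S)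
  have KR: "K \<subseteq> carrier R" by (rule subfieldE(3)[OF K])
  have S_add: "u \<oplus>\<^bsub>A\<^esub> v \<in> S" and S_mult: "u \<otimes>\<^bsub>A\<^esub> v \<in> S" if "u \<in> S" "v \<in> S" for u v
    using S.M.a_closed[of u v] S.mult_closed[of u v] that by simp_all
  have S_smult: "a \<odot>\<^bsub>A\<^esub> u \<in> S" if "a \<in> K" "u \<in> S" for a u
    using S.smult_closed[of a u] that by simp
  have h_add: "h (u \<oplus>\<^bsub>A\<^esub> v) = (\<lambda>n. h u n \<oplus> h v n)"
    and h_mult: "h (u \<otimes>\<^bsub>A\<^esub> v) = coeff_mult R N (h u) (h v)" if "u \<in> S" "v \<in> S" for u v
    using h that by (simp_all add: algebra_hom_def)
  have h_smult: "h (a \<odot>\<^bsub>A\<^esub> u) = (\<lambda>n. a \<otimes> h u n)" if "a \<in> K" "u \<in> S" for a u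
    using h that by (simp add: algebra_hom_def)
  have h_closed: "h u \<in> carrier ?LK" if "u \<in> S" for u
    using h that by (auto simp: algebra_hom_def)
  have ev: "?ev n \<in> S \<and> h (?ev n) = word_vec R n" for n
    using N
  proof (induction n rule: word_induct)
    case (letter i)
    then show ?case using y_S h_y by (auto simp: word_eval_letter)
  next
    case (product i j)
    then show ?case
      by (simp add: word_eval_prod[OF N y] S_mult h_mult R.coeff_mult_word_vec)
  qed
  have zero_S: "\<zero>\<^bsub>A\<^esub> \<in> S" using S.M.zero_closed by simp
  have "h \<zero>\<^bsub>A\<^esub> = h (\<zero> \<odot>\<^bsub>A\<^esub> \<zero>\<^bsub>A\<^esub>)" by simp
  also have "\<dots> = (\<lambda>n. \<zero> \<otimes> h \<zero>\<^bsub>A\<^esub> n)"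
    using K.zero_closed zero_S by (intro h_smult) simp_all
  also have "\<dots> = (\<lambda>n. \<zero>)"
  proof
    fix n
    have "h \<zero>\<^bsub>A\<^esub> n \<in> carrier R"
      using h_closed[OF zero_S] KR by (auto simp: word_algebra_carrier)
    then show "\<zero> \<otimes> h \<zero>\<^bsub>A\<^esub> n = \<zero>" by simp
  qed
  finally have h_zero: "h \<zero>\<^bsub>A\<^esub> = (\<lambda>n. \<zero>)" .
  have "word_map R A N y c \<in> S \<and> h (word_map R A N y c) = c"
    using c
  proof (induction c rule: K.word_algebra_induct)
    case zero
    then show ?case by (simp add: word_map_zero[OF N y] zero_S h_zero)
  next
    case (add a n c)
    have "c \<in> carrier (word_algebra R N)"
      using add(2) KR by (auto simp: word_algebra_carrier)
    moreover have "a \<in> K" "a \<in> carrier R" using add(1) KR by auto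
    ultimately show ?case
      using add(3) ev
      by (simp add: word_map_add_word[OF N y] S_add S_smult h_add h_smult)
  qed
  then show ?thesis by blast
qed

lemma free_commutative_algebraE:
  fixes B :: "('r, 'b) module"
  assumes "free_commutative_algebra TYPE('b) R A Y" and "commutative_algebra R B"
    and "f \<in> Y \<rightarrow> carrier B"
  obtains h where "h \<in> algebra_hom R A B" and "\<And>u. u \<in> Y \<Longrightarrow> h u = f u"
  using assms unfolding free_commutative_algebra_def by blast

theorem theorem2p3:
  fixes F :: "('f, 'm) ring_scheme" and K :: "'f set"
    and A :: "('f, 'a, 'n) module_scheme" and Y :: "'a set"
  assumes "field F" and "subfield K F"
    and "commutative_algebra F A"
    and "finite Y" and "Y \<subseteq> carrier A" and "card Y \<ge> 2"
    and "free_commutative_algebra TYPE(nat \<Rightarrow> 'f) (F\<lparr>carrier := K\<rparr>)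
           (generated_subalgebra (F\<lparr>carrier := K\<rparr>) A Y) Y"
  shows "free_commutative_algebra TYPE('b) F (generated_subalgebra F A Y) Y"
proof -
  interpret F: field F by (rule assms(1))
  interpret A: commutative_algebra F A by (rule assms(3))
  let ?FK = "F\<lparr>carrier := K\<rparr>"
  interpret K: field ?FK by (rule F.subfield_iff(2)[OF assms(2)])
  define N where "N = card Y"
  have N: "N > 0" using assms(6) by (simp add: N_def)
  obtain y where bij: "bij_betw y {..<N} Y"
    using ex_bij_betw_nat_finite[OF assms(4)] by (auto simp: N_def atLeast0LessThan)
  then have Y: "Y = y ` {..<N}" and inj_y: "inj_on y {..<N}"
    by (auto simp: bij_betw_def)
  have y: "y \<in> {..<N} \<rightarrow> carrier A" using assms(5) Y by auto
  let ?L = "word_algebra F N" and ?LK = "word_algebra ?FK N" and ?\<Phi> = "word_map F A N y"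
  define S where "S = \<Inter>{S. subalgebra S ?FK A \<and> Y \<subseteq> S}"
  have gen: "generated_subalgebra ?FK A Y = A\<lparr>carrier := S\<rparr>"
    by (simp add: generated_subalgebra_def S_def)
  have S: "commutative_algebra ?FK (A\<lparr>carrier := S\<rparr>)" and YS: "Y \<subseteq> S"
    using assms(7) by (simp_all add: free_commutative_algebra_def gen)
  \<comment> \<open>The word algebra over \<open>K\<close> is the one test algebra to which the freeness over \<open>K\<close> is applied.\<close>
  let ?f = "\<lambda>u. word_vec F (inv_into {..<N} y u)"
  have f: "?f \<in> Y \<rightarrow> carrier ?LK"
    using K.word_vec_in_algebra by simp
  obtain h where h: "h \<in> algebra_hom ?FK (A\<lparr>carrier := S\<rparr>) ?LK"
    and h_f: "\<And>u. u \<in> Y \<Longrightarrow> h u = ?f u"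
    by (rule free_commutative_algebraE
        [OF assms(7)[unfolded gen] K.word_algebra_commutative_algebra f]) (rule that)
  have h_y: "h (y i) = word_vec F i" if "i < N" for i
    using h_f that inj_y by (simp add: Y)
  have retract: "h (?\<Phi> c) = c" if "c \<in> carrier ?LK" for c
  proof (rule A.word_map_retraction_over_subfield[OF assms(2) N y _ S h _ that])
    show "y \<in> {..<N} \<rightarrow> S" using YS Y by auto
  qed (rule h_y)
  have zero_LK: "(\<lambda>n. \<zero>\<^bsub>F\<^esub>) \<in> carrier ?LK"
    using K.zero_closed by (simp add: word_algebra_carrier)
  \<comment> \<open>The kernel of \<open>\<Phi>\<close> is an ideal, and over \<open>K\<close> it is trivial by \<open>retract\<close>.\<close>
  define I where "I = {c \<in> carrier ?L. ?\<Phi> c = \<zero>\<^bsub>A\<^esub>}"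
  have kernel: "c = (\<lambda>n. \<zero>\<^bsub>F\<^esub>)" if "c \<in> I" for c
  proof (rule F.ideal_trivial_if_trivial_over_subfield[OF N assms(2), of I])
    show "(\<lambda>n. c n \<oplus>\<^bsub>F\<^esub> d n) \<in> I" if "c \<in> I" "d \<in> I" for c d
      using that by (simp add: I_def F.word_algebra_add_closed A.word_map_add[OF N y])
    show "(\<lambda>n. a \<otimes>\<^bsub>F\<^esub> c n) \<in> I" if "a \<in> carrier F" "c \<in> I" for a c
      using that by (simp add: I_def F.word_algebra_smult_closed A.word_map_smult[OF N y])
    show "coeff_mult F N c d \<in> I" if "c \<in> carrier ?L" "d \<in> I" for c d
    proof -
      have "?\<Phi> c \<otimes>\<^bsub>A\<^esub> \<zero>\<^bsub>A\<^esub> = \<zero>\<^bsub>A\<^esub>"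
        using A.mult_comm[OF A.word_map_closed[OF N y that(1)] A.M.zero_closed]
          A.mult_zero_left[OF A.word_map_closed[OF N y that(1)]] by simp
      then show ?thesis
        using that by (simp add: I_def F.word_algebra_mult_closed A.word_map_mult[OF N y])
    qed
    show "c = (\<lambda>n. \<zero>\<^bsub>F\<^esub>)" if "c \<in> I" "c \<in> carrier ?LK" for c
    proof -
      have "c = h \<zero>\<^bsub>A\<^esub>"
        using retract[OF that(2)] that(1) by (simp add: I_def)
      also have "\<dots> = (\<lambda>n. \<zero>\<^bsub>F\<^esub>)"
        using retract[OF zero_LK] by (simp add: A.word_map_zero[OF N y])
      finally show ?thesis .
    qed
    show "c \<in> I" "c \<in> carrier ?L" using that by (simp_all add: I_def)
  qed
  have "inj_on ?\<Phi> (carrier ?L)"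
  proof (rule inj_onI)
    fix c d assume cd: "c \<in> carrier ?L" "d \<in> carrier ?L" "?\<Phi> c = ?\<Phi> d"
    let ?d = "\<lambda>n. \<ominus>\<^bsub>F\<^esub> \<one>\<^bsub>F\<^esub> \<otimes>\<^bsub>F\<^esub> d n"
    have d: "?d \<in> carrier ?L"
      by (rule F.word_algebra_smult_closed) (use cd in simp_all)
    have "?\<Phi> (\<lambda>n. c n \<oplus>\<^bsub>F\<^esub> ?d n) = ?\<Phi> d \<oplus>\<^bsub>A\<^esub> (\<ominus>\<^bsub>F\<^esub> \<one>\<^bsub>F\<^esub>) \<odot>\<^bsub>A\<^esub> ?\<Phi> d"
      using cd d by (simp add: A.word_map_add[OF N y] A.word_map_smult[OF N y])
    also have "\<dots> = \<zero>\<^bsub>A\<^esub>"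
      using A.word_map_closed[OF N y cd(2)] by (simp add: A.smult_l_minus A.M.r_neg)
    finally have "(\<lambda>n. c n \<oplus>\<^bsub>F\<^esub> ?d n) \<in> I"
      using F.word_algebra_add_closed[OF cd(1) d] by (simp add: I_def)
    then have eq: "c n \<oplus>\<^bsub>F\<^esub> ?d n = \<zero>\<^bsub>F\<^esub>" for n
      using kernel by (metis (no_types, lifting))
    show "c = d"
    proof
      fix n
      have "c n \<in> carrier F" "d n \<in> carrier F"
        using cd by (simp_all add: word_algebra_carrier)
      then show "c n = d n"
        using eq[of n] F.minus_equality[of "c n" "\<ominus>\<^bsub>F\<^esub> d n"] by (simp add: F.l_minus)
    qed
  qed
  then show ?thesis
    unfolding Y by (rule A.free_if_word_map_injective[OF N y _ inj_y])
qed

end
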